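(* Let $\alpha=(\alpha_i)_{i\in\mathbb{N}}$ be a bounded sequence of strictly positive real numbers, and let $W_\alpha$ be the associated unilateral weighted shift, with mean transform $\widehat{W_\alpha}$. Then $$r(W_\alpha)\leq r(\widehat{W_\alpha}),$$ where $r$ denotes the spectral radius.
   Context: Here $\mathbb{N}=\{0,1,2,\dots\}$ and $\ell^2(\mathbb{N})$ is the Hilbert space of complex square-summable sequences. For a bounded sequence $\alpha=(\alpha_i)_{i\in\mathbb{N}}$ of strictly positive numbers, the unilateral weighted shift $W_\alpha:\ell^2(\mathbb{N})\to\ell^2(\mathbb{N})$ is $W_\alpha(x_0,x_1,\dots):=(0,\alpha_0x_0,\alpha_1x_1,\dots)$. For a bounded operator $T$ on a Hilbert space, $|T|:=(T^*T)^{1/2}$, and the canonical polar decomposition is $T=V|T|$ where $V$ is the partial isometry with null space $\mathcal{N}(V)=\mathcal{N}(T)$. The mean transform of $T$ is $\widehat{T}:=\frac12(V|T|+|T|V)$. *)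

theory Defs
  imports "HOL-Analysis.Analysis"
begin

section \<open>Complex Hilbert spaces\<close>

text \<open>The complex inner product is linear in its first argument; the real inner product of the
  superclass is its real part, so that norm and topology are the usual ones.\<close>

class complex_hilbert = real_inner + complete_space +
  fixes scaleC :: "complex \<Rightarrow> 'a \<Rightarrow> 'a"  (infixr \<open>*\<^sub>C\<close> 75)
    and cinner :: "'a \<Rightarrow> 'a \<Rightarrow> complex"
  assumes scaleC_add_right: "c *\<^sub>C (x + y) = c *\<^sub>C x + c *\<^sub>C y"
    and scaleC_add_left: "(c + d) *\<^sub>C x = c *\<^sub>C x + d *\<^sub>C x"
    and scaleC_scaleC: "c *\<^sub>C d *\<^sub>C x = (c * d) *\<^sub>C x"
    and scaleC_of_real: "complex_of_real r *\<^sub>C x = r *\<^sub>R x"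
    and cinner_add_left: "cinner (x + y) z = cinner x z + cinner y z"
    and cinner_scaleC_left: "cinner (c *\<^sub>C x) y = c * cinner x y"
    and cinner_commute: "cinner x y = cnj (cinner y x)"
    and inner_eq_Re_cinner: "inner x y = Re (cinner x y)"


section \<open>Bounded operators\<close>

definition bounded_clinear :: "('a::complex_hilbert \<Rightarrow> 'b::complex_hilbert) \<Rightarrow> bool" where
  "bounded_clinear T \<longleftrightarrow> bounded_linear T \<and> (\<forall>c x. T (c *\<^sub>C x) = c *\<^sub>C T x)"

definition hilbert_adjoint :: "('a::complex_hilbert \<Rightarrow> 'b::complex_hilbert) \<Rightarrow> ('b \<Rightarrow> 'a)" where
  "hilbert_adjoint T = (THE S. \<forall>x y. cinner (T x) y = cinner x (S y))"

definition positive_operator :: "('a::complex_hilbert \<Rightarrow> 'a) \<Rightarrow> bool" where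
  "positive_operator T \<longleftrightarrow> bounded_clinear T \<and> (\<forall>x. cinner (T x) x \<in> \<real>\<^sub>\<ge>\<^sub>0)"

definition operator_sqrt :: "('a::complex_hilbert \<Rightarrow> 'a) \<Rightarrow> ('a \<Rightarrow> 'a)" where
  "operator_sqrt A = (THE P. positive_operator P \<and> P \<circ> P = A)"

definition abs_operator :: "('a::complex_hilbert \<Rightarrow> 'a) \<Rightarrow> ('a \<Rightarrow> 'a)" where
  "abs_operator T = operator_sqrt (hilbert_adjoint T \<circ> T)"

definition null_space :: "('a::complex_hilbert \<Rightarrow> 'b::complex_hilbert) \<Rightarrow> 'a set" where
  "null_space T = {x. T x = 0}"

definition partial_isometry :: "('a::complex_hilbert \<Rightarrow> 'b::complex_hilbert) \<Rightarrow> bool" where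
  "partial_isometry V \<longleftrightarrow> bounded_clinear V \<and>
     (\<forall>x. (\<forall>y\<in>null_space V. cinner x y = 0) \<longrightarrow> norm (V x) = norm x)"

text \<open>The partial isometry of the canonical polar decomposition.\<close>

definition polar_isometry :: "('a::complex_hilbert \<Rightarrow> 'a) \<Rightarrow> ('a \<Rightarrow> 'a)" where
  "polar_isometry T =
     (THE V. partial_isometry V \<and> null_space V = null_space T \<and> T = V \<circ> abs_operator T)"

definition mean_transform :: "('a::complex_hilbert \<Rightarrow> 'a) \<Rightarrow> ('a \<Rightarrow> 'a)" where
  "mean_transform T = (\<lambda>x. (1/2) *\<^sub>C
     (polar_isometry T (abs_operator T x) + abs_operator T (polar_isometry T x)))"

definition spectrum :: "('a::complex_hilbert \<Rightarrow> 'a) \<Rightarrow> complex set" where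
  "spectrum T = {z. \<not> (\<exists>S. bounded_clinear S \<and>
     S \<circ> (\<lambda>x. T x - z *\<^sub>C x) = id \<and> (\<lambda>x. T x - z *\<^sub>C x) \<circ> S = id)}"

definition spectral_radius :: "('a::complex_hilbert \<Rightarrow> 'a) \<Rightarrow> real" where
  "spectral_radius T = (SUP z\<in>spectrum T. cmod z)"


section \<open>Square-summable sequences\<close>

typedef ell2 = "{x :: nat \<Rightarrow> complex. summable (\<lambda>n. (cmod (x n))\<^sup>2)}"
  morphisms ell2_nth Abs_ell2
  by (rule exI [of _ "\<lambda>_. 0"]) simp

setup_lifting type_definition_ell2

lemma ell2_eqI: "(\<And>n. ell2_nth x n = ell2_nth y n) \<Longrightarrow> x = y"
  by (simp add: ell2_nth_inject [symmetric] fun_eq_iff)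

lemma summable_ell2_nth: "summable (\<lambda>n. (cmod (ell2_nth x n))\<^sup>2)"
  using ell2_nth [of x] by simp

lemma square_summable_add:
  fixes x y :: "nat \<Rightarrow> complex"
  assumes "summable (\<lambda>n. (cmod (x n))\<^sup>2)" "summable (\<lambda>n. (cmod (y n))\<^sup>2)"
  shows "summable (\<lambda>n. (cmod (x n + y n))\<^sup>2)"
proof (rule summable_comparison_test')
  show "summable (\<lambda>n. 2 * (cmod (x n))\<^sup>2 + 2 * (cmod (y n))\<^sup>2)"
    using assms by (intro summable_add summable_mult)
  fix n :: nat
  have "(cmod (x n + y n))\<^sup>2 \<le> (cmod (x n) + cmod (y n))\<^sup>2"
    by (intro power_mono norm_triangle_ineq) simp
  also have "\<dots> \<le> 2 * (cmod (x n))\<^sup>2 + 2 * (cmod (y n))\<^sup>2"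
    using sum_squares_ge_zero [of "cmod (x n) - cmod (y n)" 0]
    by (simp add: power2_eq_square algebra_simps)
  finally show "norm ((cmod (x n + y n))\<^sup>2) \<le> 2 * (cmod (x n))\<^sup>2 + 2 * (cmod (y n))\<^sup>2"
    by simp
qed

lemma square_summable_mult_left:
  fixes x :: "nat \<Rightarrow> complex"
  assumes "summable (\<lambda>n. (cmod (x n))\<^sup>2)"
  shows "summable (\<lambda>n. (cmod (c * x n))\<^sup>2)"
  using summable_mult [OF assms, of "(cmod c)\<^sup>2"] by (simp add: norm_mult power_mult_distrib)

lemma summable_ell2_product: "summable (\<lambda>n. ell2_nth x n * cnj (ell2_nth y n))"
proof (rule summable_comparison_test')
  show "summable (\<lambda>n. (cmod (ell2_nth x n))\<^sup>2 + (cmod (ell2_nth y n))\<^sup>2)"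
    by (intro summable_add summable_ell2_nth)
  fix n :: nat
  show "norm (ell2_nth x n * cnj (ell2_nth y n)) \<le> (cmod (ell2_nth x n))\<^sup>2 + (cmod (ell2_nth y n))\<^sup>2"
    using sum_squares_bound [of "cmod (ell2_nth x n)" "cmod (ell2_nth y n)"]
      mult_nonneg_nonneg [OF norm_ge_zero norm_ge_zero, of "ell2_nth x n" "ell2_nth y n"]
    unfolding norm_mult complex_mod_cnj by linarith
qed

instantiation ell2 :: real_inner
begin

lift_definition zero_ell2 :: ell2 is "\<lambda>_. 0" by simp

lift_definition plus_ell2 :: "ell2 \<Rightarrow> ell2 \<Rightarrow> ell2" is "\<lambda>x y n. x n + y n"
  by (rule square_summable_add)

lift_definition uminus_ell2 :: "ell2 \<Rightarrow> ell2" is "\<lambda>x n. - x n"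
  by simp

definition minus_ell2 :: "ell2 \<Rightarrow> ell2 \<Rightarrow> ell2" where
  "minus_ell2 x y = x + (- y)"

lift_definition scaleR_ell2 :: "real \<Rightarrow> ell2 \<Rightarrow> ell2" is "\<lambda>r x n. complex_of_real r * x n"
  by (rule square_summable_mult_left)

definition inner_ell2 :: "ell2 \<Rightarrow> ell2 \<Rightarrow> real" where
  "inner_ell2 x y = Re (\<Sum>n. ell2_nth x n * cnj (ell2_nth y n))"

definition norm_ell2 :: "ell2 \<Rightarrow> real" where
  "norm_ell2 x = sqrt (inner x x)"

definition dist_ell2 :: "ell2 \<Rightarrow> ell2 \<Rightarrow> real" where
  "dist_ell2 x y = norm (x - y)"

definition sgn_ell2 :: "ell2 \<Rightarrow> ell2" where
  "sgn_ell2 x = inverse (norm x) *\<^sub>R x"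

definition uniformity_ell2 :: "(ell2 \<times> ell2) filter" where
  "uniformity_ell2 = (INF e\<in>{0<..}. principal {(x, y). dist x y < e})"

definition open_ell2 :: "ell2 set \<Rightarrow> bool" where
  "open_ell2 U \<longleftrightarrow> (\<forall>x\<in>U. eventually (\<lambda>(x', y). x' = x \<longrightarrow> y \<in> U) uniformity)"

lemma inner_ell2_self: "inner x x = (\<Sum>n. (cmod (ell2_nth x n))\<^sup>2)" for x :: ell2
proof -
  have "(\<Sum>n. ell2_nth x n * cnj (ell2_nth x n)) = (\<Sum>n. complex_of_real ((cmod (ell2_nth x n))\<^sup>2))"
    by (simp only: complex_norm_square)
  also have "\<dots> = complex_of_real (\<Sum>n. (cmod (ell2_nth x n))\<^sup>2)"
    by (rule suminf_of_real [OF summable_ell2_nth, symmetric])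
  finally show ?thesis
    by (simp add: inner_ell2_def)
qed

instance
proof
  fix x y z :: ell2 and a b :: real
  show "x + y + z = x + (y + z)" by transfer (simp add: add.assoc)
  show "x + y = y + x" by transfer (simp add: add.commute)
  show "0 + x = x" by transfer simp
  show "- x + x = 0" by transfer simp
  show "x - y = x + - y" by (rule minus_ell2_def)
  show "a *\<^sub>R (x + y) = a *\<^sub>R x + a *\<^sub>R y" by transfer (simp add: distrib_left)
  show "(a + b) *\<^sub>R x = a *\<^sub>R x + b *\<^sub>R x" by transfer (simp add: distrib_right)
  show "a *\<^sub>R b *\<^sub>R x = (a * b) *\<^sub>R x" by transfer (simp add: mult.assoc)
  show "1 *\<^sub>R x = x" by transfer simp
  show "sgn x = inverse (norm x) *\<^sub>R x" by (rule sgn_ell2_def)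
  show "dist x y = norm (x - y)" by (rule dist_ell2_def)
  show "(uniformity :: (ell2 \<times> ell2) filter) = (INF e\<in>{0<..}. principal {(x, y). dist x y < e})"
    by (rule uniformity_ell2_def)
  show "open U \<longleftrightarrow> (\<forall>x\<in>U. \<forall>\<^sub>F (x', y) in uniformity. x' = x \<longrightarrow> y \<in> U)" for U :: "ell2 set"
    by (rule open_ell2_def)
  show "inner x y = inner y x"
  proof -
    have "(\<lambda>n. cnj (ell2_nth x n * cnj (ell2_nth y n))) sums
        cnj (\<Sum>n. ell2_nth x n * cnj (ell2_nth y n))"
      unfolding sums_cnj by (rule summable_sums [OF summable_ell2_product])
    then show ?thesis
      unfolding inner_ell2_def by (simp add: sums_iff mult.commute)
  qed
  show "inner (x + y) z = inner x z + inner y z"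
    unfolding inner_ell2_def plus_ell2.rep_eq distrib_right
    by (subst suminf_add [symmetric]) (simp_all add: summable_ell2_product)
  show "inner (a *\<^sub>R x) y = a * inner x y"
    unfolding inner_ell2_def scaleR_ell2.rep_eq mult.assoc
    by (subst suminf_mult) (simp_all add: summable_ell2_product)
  show "0 \<le> inner x x"
    unfolding inner_ell2_self by (intro suminf_nonneg summable_ell2_nth) simp
  show "inner x x = 0 \<longleftrightarrow> x = 0"
  proof
    assume "inner x x = 0"
    then have "ell2_nth x n = 0" for n
      using suminf_eq_zero_iff [OF summable_ell2_nth [of x]] by (simp add: inner_ell2_self)
    then show "x = 0"
      by (intro ell2_eqI) (simp add: zero_ell2.rep_eq)
  next
    assume "x = 0"
    then show "inner x x = 0"
      by (simp add: inner_ell2_self zero_ell2.rep_eq)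
  qed
  show "norm x = sqrt (inner x x)" by (rule norm_ell2_def)
qed

end

lemma ell2_nth_diff: "ell2_nth (x - y) n = ell2_nth x n - ell2_nth y n"
  unfolding minus_ell2_def plus_ell2.rep_eq uminus_ell2.rep_eq by simp

lemma norm_ell2_eq: "norm x = sqrt (\<Sum>n. (cmod (ell2_nth x n))\<^sup>2)" for x :: ell2
  unfolding norm_ell2_def inner_ell2_self ..

lemma ell2_complete:
  fixes X :: "nat \<Rightarrow> ell2"
  assumes "Cauchy X"
  shows "convergent X"
proof -
  have X: "\<exists>M. \<forall>m\<ge>M. \<forall>n\<ge>M. dist (X m) (X n) < e" if "e > 0" for e
    using assms that by (rule metric_CauchyD)
  have dist_sq: "(dist x y)\<^sup>2 = (\<Sum>n. (cmod (ell2_nth x n - ell2_nth y n))\<^sup>2)" for x y :: ell2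
    by (simp add: dist_norm power2_norm_eq_inner inner_ell2_self ell2_nth_diff)
  have summable_diff: "summable (\<lambda>n. (cmod (ell2_nth x n - ell2_nth y n))\<^sup>2)" for x y :: ell2
    using summable_ell2_nth [of "x - y"] by (simp add: ell2_nth_diff)
  have partial: "(\<Sum>n<K. (cmod (ell2_nth x n - ell2_nth y n))\<^sup>2) \<le> (dist x y)\<^sup>2" for x y :: ell2 and K
    unfolding dist_sq by (rule sum_le_suminf [OF summable_diff]) auto
  have coord: "cmod (ell2_nth x k - ell2_nth y k) \<le> dist x y" for x y :: ell2 and k
  proof (rule power2_le_imp_le [OF _ zero_le_dist])
    have "(cmod (ell2_nth x k - ell2_nth y k))\<^sup>2
        \<le> (\<Sum>n<Suc k. (cmod (ell2_nth x n - ell2_nth y n))\<^sup>2)"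
      by (simp add: sum_nonneg)
    then show "(cmod (ell2_nth x k - ell2_nth y k))\<^sup>2 \<le> (dist x y)\<^sup>2"
      using partial order_trans by blast
  qed
  have "Cauchy (\<lambda>m. ell2_nth (X m) k)" for k
  proof (rule metric_CauchyI)
    fix e :: real
    assume "e > 0"
    from X [OF this] obtain M where "\<forall>m\<ge>M. \<forall>n\<ge>M. dist (X m) (X n) < e" by blast
    then have "dist (ell2_nth (X m) k) (ell2_nth (X n) k) < e" if "m \<ge> M" "n \<ge> M" for m n
      using that coord [of "X m" k "X n"] unfolding dist_complex_def by force
    then show "\<exists>M. \<forall>m\<ge>M. \<forall>n\<ge>M. dist (ell2_nth (X m) k) (ell2_nth (X n) k) < e"
      by blast
  qed
  then have "convergent (\<lambda>m. ell2_nth (X m) k)" for k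
    by (rule Cauchy_convergent)
  then obtain l where l: "\<And>k. (\<lambda>m. ell2_nth (X m) k) \<longlonglongrightarrow> l k"
    unfolding convergent_def by metis
  have bound: "(\<Sum>n<K. (cmod (ell2_nth (X m) n - l n))\<^sup>2) \<le> e\<^sup>2"
    if M: "\<forall>m\<ge>M. \<forall>n\<ge>M. dist (X m) (X n) < e" and m: "m \<ge> M" for e M m K
  proof (rule tendsto_upperbound)
    show "(\<lambda>j. \<Sum>n<K. (cmod (ell2_nth (X m) n - ell2_nth (X j) n))\<^sup>2)
        \<longlonglongrightarrow> (\<Sum>n<K. (cmod (ell2_nth (X m) n - l n))\<^sup>2)"
      by (intro tendsto_intros l)
    show "\<forall>\<^sub>F j in sequentially. (\<Sum>n<K. (cmod (ell2_nth (X m) n - ell2_nth (X j) n))\<^sup>2) \<le> e\<^sup>2"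
    proof (rule eventually_sequentiallyI [of M])
      fix j
      assume "j \<ge> M"
      then have "(dist (X m) (X j))\<^sup>2 \<le> e\<^sup>2"
        using M m by (intro power_mono zero_le_dist less_imp_le) auto
      then show "(\<Sum>n<K. (cmod (ell2_nth (X m) n - ell2_nth (X j) n))\<^sup>2) \<le> e\<^sup>2"
        using partial order_trans by blast
    qed
  qed simp
  have summable_lim: "summable (\<lambda>n. (cmod (ell2_nth (X m) n - l n))\<^sup>2)"
    if "\<forall>m\<ge>M. \<forall>n\<ge>M. dist (X m) (X n) < e" "m \<ge> M" for e M m
    using bound [OF that] by (intro summableI_nonneg_bounded [where x = "e\<^sup>2"]) auto
  obtain M1 where M1: "\<forall>m\<ge>M1. \<forall>n\<ge>M1. dist (X m) (X n) < 1"
    using X [of 1] by auto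
  have "summable (\<lambda>n. (cmod (ell2_nth (X M1) n + - 1 * (ell2_nth (X M1) n - l n)))\<^sup>2)"
    by (intro square_summable_add square_summable_mult_left summable_ell2_nth
        summable_lim [OF M1 order_refl])
  then have "summable (\<lambda>n. (cmod (l n))\<^sup>2)"
    by simp
  then have nth_L: "ell2_nth (Abs_ell2 l) = l"
    by (simp add: Abs_ell2_inverse)
  have "X \<longlonglongrightarrow> Abs_ell2 l"
  proof (rule metric_LIMSEQ_I)
    fix r :: real
    assume r: "r > 0"
    define e where "e = r / 2"
    from r have e: "e > 0" "e < r" by (simp_all add: e_def)
    from X [OF e(1)] obtain M where M: "\<forall>m\<ge>M. \<forall>n\<ge>M. dist (X m) (X n) < e" by blast
    have "dist (X m) (Abs_ell2 l) < r" if "m \<ge> M" for m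
    proof -
      have "(dist (X m) (Abs_ell2 l))\<^sup>2 \<le> e\<^sup>2"
        unfolding dist_sq nth_L
        by (rule suminf_le_const [OF summable_lim [OF M that] bound [OF M that]])
      then have "dist (X m) (Abs_ell2 l) \<le> e"
        by (rule power2_le_imp_le) (use e in simp)
      with e show ?thesis by simp
    qed
    then show "\<exists>M. \<forall>m\<ge>M. dist (X m) (Abs_ell2 l) < r" by blast
  qed
  then show ?thesis
    by (rule convergentI)
qed

instantiation ell2 :: complex_hilbert
begin

lift_definition scaleC_ell2 :: "complex \<Rightarrow> ell2 \<Rightarrow> ell2" is "\<lambda>c x n. c * x n"
  by (rule square_summable_mult_left)

definition cinner_ell2 :: "ell2 \<Rightarrow> ell2 \<Rightarrow> complex" where
  "cinner_ell2 x y = (\<Sum>n. ell2_nth x n * cnj (ell2_nth y n))"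

instance
proof
  fix x y z :: ell2 and r :: real and c d :: complex
  show "convergent X" if "Cauchy X" for X :: "nat \<Rightarrow> ell2"
    using that by (rule ell2_complete)
  show "c *\<^sub>C (x + y) = c *\<^sub>C x + c *\<^sub>C y" by transfer (simp add: distrib_left)
  show "(c + d) *\<^sub>C x = c *\<^sub>C x + d *\<^sub>C x" by transfer (simp add: distrib_right)
  show "c *\<^sub>C d *\<^sub>C x = (c * d) *\<^sub>C x" by transfer (simp add: mult.assoc)
  show "complex_of_real r *\<^sub>C x = r *\<^sub>R x" by transfer simp
  show "cinner (x + y) z = cinner x z + cinner y z"
    unfolding cinner_ell2_def plus_ell2.rep_eq distrib_right
    by (subst suminf_add [symmetric]) (simp_all add: summable_ell2_product)
  show "cinner (c *\<^sub>C x) y = c * cinner x y"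
    unfolding cinner_ell2_def scaleC_ell2.rep_eq mult.assoc
    by (subst suminf_mult) (simp_all add: summable_ell2_product)
  show "cinner x y = cnj (cinner y x)"
  proof -
    have "(\<lambda>n. cnj (ell2_nth y n * cnj (ell2_nth x n))) sums cnj (cinner y x)"
      unfolding sums_cnj cinner_ell2_def by (rule summable_sums [OF summable_ell2_product])
    then show ?thesis
      unfolding cinner_ell2_def [of x y] by (simp add: sums_iff mult.commute)
  qed
  show "inner x y = Re (cinner x y)"
    by (simp add: inner_ell2_def cinner_ell2_def)
qed

end


section \<open>Weighted shifts\<close>

text \<open>The value is meaningful only if the weights map square-summable sequences to
  square-summable sequences, in particular if they are bounded.\<close>

definition weighted_shift :: "(nat \<Rightarrow> real) \<Rightarrow> ell2 \<Rightarrow> ell2" where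
  "weighted_shift \<alpha> x =
     Abs_ell2 (\<lambda>n. case n of 0 \<Rightarrow> 0 | Suc m \<Rightarrow> complex_of_real (\<alpha> m) * ell2_nth x m)"

lemma ell2_nth_weighted_shift:
  assumes "bounded (range \<alpha>)"
  shows "ell2_nth (weighted_shift \<alpha> x) 0 = 0"
    and "ell2_nth (weighted_shift \<alpha> x) (Suc m) = complex_of_real (\<alpha> m) * ell2_nth x m"
proof -
  let ?y = "\<lambda>n. case n of 0 \<Rightarrow> 0 | Suc m \<Rightarrow> complex_of_real (\<alpha> m) * ell2_nth x m"
  obtain B where B: "\<And>m. \<bar>\<alpha> m\<bar> \<le> B"
    using assms by (auto simp: bounded_iff)
  have "summable (\<lambda>n. (cmod (?y (Suc n)))\<^sup>2)"
  proof (rule summable_comparison_test')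
    show "summable (\<lambda>n. B\<^sup>2 * (cmod (ell2_nth x n))\<^sup>2)"
      by (intro summable_mult summable_ell2_nth)
    fix n :: nat
    have "\<bar>\<alpha> n\<bar>\<^sup>2 \<le> B\<^sup>2"
      by (intro power_mono B) simp
    then show "norm ((cmod (?y (Suc n)))\<^sup>2) \<le> B\<^sup>2 * (cmod (ell2_nth x n))\<^sup>2"
      by (simp add: norm_mult power_mult_distrib mult_right_mono)
  qed
  then have "summable (\<lambda>n. (cmod (?y n))\<^sup>2)"
    by (subst (asm) summable_Suc_iff)
  then have "ell2_nth (weighted_shift \<alpha> x) = ?y"
    unfolding weighted_shift_def by (simp add: Abs_ell2_inverse)
  then show "ell2_nth (weighted_shift \<alpha> x) 0 = 0"
    and "ell2_nth (weighted_shift \<alpha> x) (Suc m) = complex_of_real (\<alpha> m) * ell2_nth x m"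
    by simp_all
qed

end

theory Submission
  imports Defs
begin

text \<open>The mean transform of the weighted shift with weights \<open>\<alpha>\<^sub>i\<close> is the weighted shift with
  weights \<open>\<beta>\<^sub>i = (\<alpha>\<^sub>i + \<alpha>\<^bsub>i+1\<^esub>) / 2\<close>. By AM-GM, a product of \<open>n + 1\<close> consecutive \<open>\<alpha>\<close>'s is at most
  \<open>sup \<alpha>\<close> times the product of the \<open>n\<close> corresponding \<open>\<beta>\<close>'s. If \<open>z\<close> is in the resolvent set of
  \<open>W\<^sub>\<beta>\<close>, then the columns of the resolvent, whose entries are products of \<open>\<beta>\<close>'s divided by powers
  of \<open>z\<close>, are uniformly square-summable, and this already forces these entries to tend to zero
  uniformly. Hence some power of \<open>W\<^sub>\<alpha>\<close>, say the \<open>N\<close>-th, has norm below \<open>\<bar>z\<bar>\<^sup>N\<close>, so \<open>z\<close> is in the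
  resolvent set of \<open>W\<^sub>\<alpha>\<close>. Thus even the spectrum of \<open>W\<^sub>\<alpha>\<close> is contained in that of \<open>W\<^sub>\<beta>\<close>.\<close>

section \<open>Inverting an operator with a contracting power\<close>

lemma scaleC_minus_right: "c *\<^sub>C (x - y) = c *\<^sub>C x - c *\<^sub>C (y::'a::complex_hilbert)"
  using scaleC_add_right [of c "x - y" y] by (simp add: algebra_simps)

lemma scaleC_zero_right [simp]: "c *\<^sub>C (0::'a::complex_hilbert) = 0"
  using scaleC_minus_right [of c 0 0] by simp

lemma scaleC_one [simp]: "1 *\<^sub>C (x::'a::complex_hilbert) = x"
  using scaleC_of_real [of 1 x] by simp

text \<open>Conjugate symmetry pulls \<open>c\<close> out of both slots of \<open>cinner\<close>;
  the resulting factor \<open>c * cnj c\<close> is real and hence passes through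
  \<open>Re\<close>.\<close>

lemma norm_scaleC: "norm (c *\<^sub>C x) = cmod c * norm (x::'a::complex_hilbert)"
proof -
  have "cinner (c *\<^sub>C x) (c *\<^sub>C x) = c * cnj c * cinner x x"
    using cinner_commute [of x "c *\<^sub>C x"] cinner_commute [of x x]
    by (simp add: cinner_scaleC_left)
  then have "inner (c *\<^sub>C x) (c *\<^sub>C x) = (cmod c)\<^sup>2 * inner x x"
    unfolding inner_eq_Re_cinner by (simp flip: complex_norm_square of_real_power)
  then have "(norm (c *\<^sub>C x))\<^sup>2 = (cmod c * norm x)\<^sup>2"
    by (simp add: power2_norm_eq_inner power_mult_distrib)
  then show ?thesis
    by simp
qed

lemma bounded_clinearI:
  assumes "\<And>x y. T (x + y) = T x + T y" "\<And>c x. T (c *\<^sub>C x) = c *\<^sub>C T x"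
    and "\<And>x. norm (T x) \<le> K * norm x"
  shows "bounded_clinear T"
  unfolding bounded_clinear_def
proof
  show "bounded_linear T"
    by (rule bounded_linear_intro [where K = K])
      (use assms in \<open>simp_all add: mult.commute flip: scaleC_of_real\<close>)
qed (simp add: assms)

lemma bounded_clinear_id: "bounded_clinear (\<lambda>x. x)"
  by (rule bounded_clinearI [where K = 1]) simp_all

lemma bounded_clinear_scaleC: "bounded_clinear ((*\<^sub>C) c)"
  by (rule bounded_clinearI [where K = "cmod c"])
    (simp_all add: scaleC_add_right scaleC_scaleC norm_scaleC mult.commute)

lemma bounded_clinear_compose:
  "bounded_clinear S \<Longrightarrow> bounded_clinear T \<Longrightarrow> bounded_clinear (\<lambda>x. S (T x))"
  unfolding bounded_clinear_def by (auto intro: bounded_linear_compose)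

lemma bounded_clinear_add:
  "bounded_clinear S \<Longrightarrow> bounded_clinear T \<Longrightarrow> bounded_clinear (\<lambda>x. S x + T x)"
  unfolding bounded_clinear_def by (auto intro: bounded_linear_add simp: scaleC_add_right)

lemma bounded_clinear_funpow:
  fixes T :: "'a::complex_hilbert \<Rightarrow> 'a"
  shows "bounded_clinear T \<Longrightarrow> bounded_clinear (T ^^ n)"
proof (induction n)
  case (Suc n)
  then show ?case
    using bounded_clinear_compose [of T "T ^^ n"] by (simp add: comp_def)
qed (simp add: id_def bounded_clinear_id)

text \<open>Solvability comes from Banach's fixed point theorem; uniqueness and boundedness of the
  solution map come from the bound \<open>lower\<close>, a reverse triangle inequality.\<close>

lemma contraction_resolvent:
  fixes T :: "'a::complex_hilbert \<Rightarrow> 'a"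
  assumes T: "bounded_clinear T" and c: "0 \<le> c" "\<And>x. norm (T x) \<le> c * norm x" "c < cmod w"
  obtains U where "bounded_clinear U" "\<And>y. T (U y) - w *\<^sub>C U y = y"
proof -
  interpret T: bounded_linear T
    using T by (simp add: bounded_clinear_def)
  have TC: "T (a *\<^sub>C x) = a *\<^sub>C T x" for a x
    using T by (simp add: bounded_clinear_def)
  have lower: "(cmod w - c) * norm x \<le> norm (T x - w *\<^sub>C x)" for x
  proof -
    have "norm (w *\<^sub>C x) \<le> norm (T x) + norm (T x - w *\<^sub>C x)"
      using norm_triangle_ineq4 [of "T x" "T x - w *\<^sub>C x"] by simp
    then show ?thesis
      using c(2) [of x] by (simp add: norm_scaleC left_diff_distrib)
  qed
  have w: "w \<noteq> 0" using c by auto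
  have ex: "\<exists>x. T x - w *\<^sub>C x = y" for y
  proof -
    \<comment> \<open>The fixed points of \<open>f\<close> are exactly the solutions of
      \<open>T x - w *\<^sub>C x = y\<close>; dividing by \<open>w\<close> makes the Lipschitz
      constant \<open>c / cmod w\<close>, which is below 1.\<close>
    define f where "f x = (1 / w) *\<^sub>C (T x - y)" for x
    have "\<exists>!x. f x = x"
    proof (rule banach_fix_type [where c = "c / cmod w"])
      show "\<forall>x. \<forall>y. dist (f x) (f y) \<le> c / cmod w * dist x y"
      proof (intro allI)
        fix a b
        have "f a - f b = (1 / w) *\<^sub>C T (a - b)"
          unfolding f_def by (simp add: scaleC_minus_right T.diff)
        then have "dist (f a) (f b) = norm (T (a - b)) / cmod w"
          by (simp add: dist_norm norm_scaleC norm_divide)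
        also have "\<dots> \<le> c * norm (a - b) / cmod w"
          by (intro divide_right_mono c(2)) simp
        finally show "dist (f a) (f b) \<le> c / cmod w * dist a b"
          by (simp add: dist_norm)
      qed
    qed (use c w in simp_all)
    then obtain x where x: "f x = x" by auto
    have "w *\<^sub>C x = w *\<^sub>C f x" by (simp add: x)
    also have "\<dots> = T x - y"
      using w by (simp add: f_def scaleC_scaleC)
    finally show ?thesis by (intro exI [of _ x]) simp
  qed
  then obtain U where U: "\<And>y. T (U y) - w *\<^sub>C U y = y" by metis
  have inj: "a = b" if "T a - w *\<^sub>C a = T b - w *\<^sub>C b" for a b
  proof -
    have "T (a - b) - w *\<^sub>C (a - b) = 0"
      using that by (simp add: T.diff scaleC_minus_right algebra_simps)
    then have "(cmod w - c) * norm (a - b) \<le> 0"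
      using lower [of "a - b"] by simp
    then show ?thesis
      using c(3) by (simp add: mult_le_0_iff)
  qed
  have "bounded_clinear U"
  proof (rule bounded_clinearI [where K = "1 / (cmod w - c)"])
    fix x y a
    show "U (x + y) = U x + U y"
    proof (rule inj)
      have "T (U x + U y) - w *\<^sub>C (U x + U y)
          = (T (U x) - w *\<^sub>C U x) + (T (U y) - w *\<^sub>C U y)"
        by (simp add: T.add scaleC_add_right)
      then show "T (U (x + y)) - w *\<^sub>C U (x + y) = T (U x + U y) - w *\<^sub>C (U x + U y)"
        by (simp add: U)
    qed
    show "U (a *\<^sub>C x) = a *\<^sub>C U x"
    proof (rule inj)
      have "T (a *\<^sub>C U x) - w *\<^sub>C a *\<^sub>C U x = a *\<^sub>C (T (U x) - w *\<^sub>C U x)"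
        by (simp add: TC scaleC_minus_right scaleC_scaleC mult.commute)
      then show "T (U (a *\<^sub>C x)) - w *\<^sub>C U (a *\<^sub>C x) = T (a *\<^sub>C U x) - w *\<^sub>C a *\<^sub>C U x"
        by (simp add: U)
    qed
    show "norm (U x) \<le> 1 / (cmod w - c) * norm x"
      using lower [of "U x"] c(3) by (simp add: U field_simps)
  qed
  then show thesis using U that by blast
qed

text \<open>Telescoping: \<open>R\<close> is constructed as the geometric sum of
  \<open>z ^ (n - 1 - i)\<close> times \<open>T ^^ i\<close> over \<open>i < n\<close>. Passing from
  \<open>n\<close> to \<open>Suc n\<close> multiplies it by \<open>z\<close> and adds
  \<open>T ^^ n\<close>.\<close>

lemma funpow_diff_factor:
  fixes T :: "'a::complex_hilbert \<Rightarrow> 'a"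
  assumes T: "bounded_clinear T"
  obtains R where "bounded_clinear R"
    "\<And>x. T (R x) - z *\<^sub>C R x = (T ^^ n) x - z ^ n *\<^sub>C x"
proof -
  have "\<exists>R. bounded_clinear R \<and> (\<forall>x. T (R x) - z *\<^sub>C R x = (T ^^ n) x - z ^ n *\<^sub>C x)"
  proof (induction n)
    case 0
    have "bounded_clinear (\<lambda>x::'a. 0::'a)"
      by (rule bounded_clinearI [where K = 0]) simp_all
    moreover have "T 0 = 0"
      using T by (simp add: bounded_clinear_def linear_simps)
    ultimately show ?case by (intro exI [of _ "\<lambda>_. 0"]) simp
  next
    case (Suc n)
    then obtain R where R: "bounded_clinear R"
      "\<And>x. T (R x) - z *\<^sub>C R x = (T ^^ n) x - z ^ n *\<^sub>C x" by blast
    let ?R = "\<lambda>x. (T ^^ n) x + z *\<^sub>C R x"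
    have "bounded_clinear ?R"
      by (intro bounded_clinear_add bounded_clinear_funpow T
          bounded_clinear_compose [OF bounded_clinear_scaleC R(1)])
    moreover have "T (?R x) - z *\<^sub>C ?R x = (T ^^ Suc n) x - z ^ Suc n *\<^sub>C x" for x
    proof -
      have "T (?R x) - z *\<^sub>C ?R x
          = T ((T ^^ n) x) - z *\<^sub>C (T ^^ n) x + z *\<^sub>C (T (R x) - z *\<^sub>C R x)"
        using T by (simp add: bounded_clinear_def linear_simps scaleC_minus_right scaleC_add_right)
      then show ?thesis
        unfolding R(2) by (simp add: scaleC_minus_right scaleC_scaleC)
    qed
    ultimately show ?case by blast
  qed
  then show thesis using that by blast
qed

text \<open>The factorisation turns a right inverse of \<open>T ^^ n - z ^ n\<close> into one of
  \<open>T - z\<close>. As \<open>T - z\<close> is also injective, this right inverse is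
  two-sided.\<close>

lemma not_in_spectrum_if_power_contracts:
  fixes T :: "'a::complex_hilbert \<Rightarrow> 'a"
  assumes T: "bounded_clinear T"
    and c: "0 \<le> c" "\<And>x. norm ((T ^^ n) x) \<le> c * norm x" "c < cmod z ^ n"
  shows "z \<notin> spectrum T"
proof -
  obtain U where U: "bounded_clinear U" "\<And>y. (T ^^ n) (U y) - z ^ n *\<^sub>C U y = y"
    using contraction_resolvent [OF bounded_clinear_funpow [OF T, of n] c(1,2), of "z ^ n"] c(3)
    by (metis norm_power)
  obtain R where R: "bounded_clinear R"
    "\<And>x. T (R x) - z *\<^sub>C R x = (T ^^ n) x - z ^ n *\<^sub>C x"
    using funpow_diff_factor [OF T] by blast
  have TC: "T (a *\<^sub>C x) = a *\<^sub>C T x" for a x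
    using T by (simp add: bounded_clinear_def)
  have right: "T (R (U y)) - z *\<^sub>C R (U y) = y" for y
    by (simp add: R U)
  \<comment> \<open>A nonzero kernel vector would be an eigenvector of \<open>T ^^ n\<close> for
    \<open>z ^ n\<close>, stretched by a factor above \<open>c\<close>.\<close>
  have inj: "x = 0" if "T x - z *\<^sub>C x = 0" for x
  proof -
    have "(T ^^ m) x = z ^ m *\<^sub>C x" for m
      using that by (induction m) (simp_all add: TC scaleC_scaleC mult.commute)
    then have "cmod z ^ n * norm x \<le> c * norm x"
      using c(2) [of x] by (simp add: norm_scaleC norm_power)
    then show "x = 0"
      using c(3) by (simp add: mult_le_cancel_right)
  qed
  have left: "R (U (T x - z *\<^sub>C x)) = x" for x
  proof -
    let ?v = "R (U (T x - z *\<^sub>C x))"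
    have "T (?v - x) - z *\<^sub>C (?v - x) = (T ?v - z *\<^sub>C ?v) - (T x - z *\<^sub>C x)"
      using T by (simp add: bounded_clinear_def linear_simps scaleC_minus_right)
    then have "T (?v - x) - z *\<^sub>C (?v - x) = 0"
      by (simp only: right diff_self)
    from inj [OF this] show ?thesis by simp
  qed
  have "bounded_clinear (\<lambda>y. R (U y))"
    by (rule bounded_clinear_compose [OF R(1) U(1)])
  then have "\<exists>S. bounded_clinear S \<and>
     S \<circ> (\<lambda>x. T x - z *\<^sub>C x) = id \<and> (\<lambda>x. T x - z *\<^sub>C x) \<circ> S = id"
    using left right by (intro exI [of _ "\<lambda>y. R (U y)"]) (simp add: fun_eq_iff)
  then show ?thesis
    unfolding spectrum_def mem_Collect_eq not_not .
qed

text \<open>The contraction criterion with exponent 1 excludes every \<open>z\<close> beyond a norm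
  bound of \<open>T\<close>. This permits comparing the suprema in \<open>spectral_radius\<close> by
  inclusion of spectra.\<close>

lemma bdd_above_spectrum:
  fixes T :: "'a::complex_hilbert \<Rightarrow> 'a"
  assumes T: "bounded_clinear T"
  shows "bdd_above (cmod ` spectrum T)"
proof -
  obtain K where K: "0 \<le> K" "\<And>x. norm (T x) \<le> norm x * K"
    using T bounded_linear.nonneg_bounded unfolding bounded_clinear_def by blast
  have "cmod z \<le> K" if "z \<in> spectrum T" for z
    using not_in_spectrum_if_power_contracts [OF T, where n = 1 and c = K and z = z] K that
    by (fastforce simp: mult.commute not_le)
  then show ?thesis
    by (intro bdd_aboveI [of _ K]) auto
qed


section \<open>The canonical basis\<close>

lift_definition ell2_basis :: "nat \<Rightarrow> ell2" is "\<lambda>k n. if n = k then 1 else 0"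
  subgoal for k by (rule summable_finite [of "{k}"]) auto
  done

lemmas ell2_nth_simps = zero_ell2.rep_eq plus_ell2.rep_eq scaleR_ell2.rep_eq scaleC_ell2.rep_eq
  ell2_nth_diff

lemma ell2_nth_sum: "ell2_nth (sum f A) n = (\<Sum>i\<in>A. ell2_nth (f i) n)"
  by (induction A rule: infinite_finite_induct) (simp_all add: ell2_nth_simps)

lemma cinner_ell2_basis: "cinner x (ell2_basis k) = ell2_nth x k"
proof -
  have "(\<Sum>n. ell2_nth x n * cnj (ell2_nth (ell2_basis k) n))
      = (\<Sum>n\<in>{k}. ell2_nth x n * cnj (ell2_nth (ell2_basis k) n))"
    by (rule suminf_finite) (auto simp: ell2_basis.rep_eq)
  then show ?thesis
    by (simp add: cinner_ell2_def ell2_basis.rep_eq)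
qed

text \<open>Bessel's inequality for the canonical basis.\<close>

lemma sum_cmod_le_norm_ell2: "finite A \<Longrightarrow> (\<Sum>n\<in>A. (cmod (ell2_nth x n))\<^sup>2) \<le> (norm x)\<^sup>2"
  unfolding norm_ell2_eq
  by (subst real_sqrt_pow2)
    (auto intro!: sum_le_suminf suminf_nonneg summable_ell2_nth)

lemma norm_ell2_basis [simp]: "norm (ell2_basis k) = 1"
proof -
  have "(\<Sum>n. (cmod (ell2_nth (ell2_basis k) n))\<^sup>2)
      = (\<Sum>n\<in>{k}. (cmod (ell2_nth (ell2_basis k) n))\<^sup>2)"
    by (rule suminf_finite) (auto simp: ell2_basis.rep_eq)
  then show ?thesis
    by (simp add: norm_ell2_eq ell2_basis.rep_eq)
qed

text \<open>The squared norm of the remainder is the tail of a convergent series.\<close>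

lemma ell2_basis_expansion:
  "(\<lambda>N. \<Sum>k<N. ell2_nth x k *\<^sub>C ell2_basis k) \<longlonglongrightarrow> x"
proof -
  let ?t = "\<lambda>N. \<Sum>k<N. ell2_nth x k *\<^sub>C ell2_basis k"
  have nth: "ell2_nth (x - ?t N) n = (if n < N then 0 else ell2_nth x n)" for n N
    by (simp add: ell2_nth_diff ell2_nth_sum scaleC_ell2.rep_eq ell2_basis.rep_eq
        if_distrib cong: if_cong)
  let ?f = "\<lambda>n. (cmod (ell2_nth x n))\<^sup>2"
  have "(norm (x - ?t N))\<^sup>2 = suminf ?f - sum ?f {..<N}" for N
  proof -
    have "(norm (x - ?t N))\<^sup>2 = (\<Sum>n. if n < N then 0 else ?f n)"
      unfolding power2_norm_eq_inner inner_ell2_self nth by (rule suminf_cong) simp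
    also have "\<dots> = (\<Sum>n. ?f n - (if n < N then ?f n else 0))"
      by (rule suminf_cong) simp
    also have "\<dots> = suminf ?f - (\<Sum>n. if n < N then ?f n else 0)"
      by (rule suminf_diff [symmetric, OF summable_ell2_nth])
        (rule summable_finite [of "{..<N}"], auto)
    also have "(\<Sum>n. if n < N then ?f n else 0) = (\<Sum>n<N. if n < N then ?f n else 0)"
      by (rule suminf_finite) auto
    finally show ?thesis by simp
  qed
  moreover have "(\<lambda>N. suminf ?f - sum ?f {..<N}) \<longlonglongrightarrow> suminf ?f - suminf ?f"
    by (intro tendsto_intros summable_LIMSEQ summable_ell2_nth)
  ultimately have "(\<lambda>N. (norm (x - ?t N))\<^sup>2) \<longlonglongrightarrow> 0"
    by simp
  then have "(\<lambda>N. sqrt ((norm (x - ?t N))\<^sup>2)) \<longlonglongrightarrow> sqrt 0"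
    by (rule tendsto_real_sqrt)
  then have "(\<lambda>N. norm (?t N - x)) \<longlonglongrightarrow> 0"
    by (simp add: norm_minus_commute)
  then show ?thesis
    by (simp add: tendsto_norm_zero_iff LIM_zero_iff)
qed

text \<open>The basis has dense span, so linearity and continuity settle equality. This serves the
  uniqueness of both the positive square root and the polar isometry.\<close>

lemma bounded_clinear_eq_on_basis:
  fixes S T :: "ell2 \<Rightarrow> 'a::complex_hilbert"
  assumes S: "bounded_clinear S" and T: "bounded_clinear T"
    and eq: "\<And>k. S (ell2_basis k) = T (ell2_basis k)"
  shows "S = T"
proof
  fix x
  let ?t = "\<lambda>N. \<Sum>k<N. ell2_nth x k *\<^sub>C ell2_basis k"
  have lim: "(\<lambda>N. F (?t N)) \<longlonglongrightarrow> F x" if "bounded_clinear F" for F :: "ell2 \<Rightarrow> 'a"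
    using that bounded_linear.tendsto ell2_basis_expansion
    unfolding bounded_clinear_def by blast
  have F: "F (?t N) = (\<Sum>k<N. ell2_nth x k *\<^sub>C F (ell2_basis k))"
    if "bounded_clinear F" for F :: "ell2 \<Rightarrow> 'a" and N
    using that linear_sum [of F "\<lambda>k. ell2_nth x k *\<^sub>C ell2_basis k" "{..<N}"]
    by (simp add: bounded_clinear_def bounded_linear.linear)
  have "(\<lambda>N. S (?t N)) = (\<lambda>N. T (?t N))"
    by (simp add: F S T eq)
  then show "S x = T x"
    using lim [OF S] lim [OF T] LIMSEQ_unique by auto
qed

section \<open>Norms of shifted and weighted sequences\<close>

lemma norm_ell2_shifted:
  assumes "\<And>n. n < N \<Longrightarrow> ell2_nth y n = 0"
  shows "norm y = sqrt (\<Sum>n. (cmod (ell2_nth y (n + N)))\<^sup>2)"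
  unfolding norm_ell2_eq
  using suminf_split_initial_segment [OF summable_ell2_nth [of y], of N] assms by simp

text \<open>Termwise comparison after discarding \<open>N\<close> leading zeros; \<open>N\<close> is
  0 for diagonal operators, 1 for shifts and arbitrary for powers of shifts.\<close>

lemma norm_ell2_shifted_le:
  assumes "\<And>n. n < N \<Longrightarrow> ell2_nth y n = 0"
    and "\<And>n. cmod (ell2_nth y (n + N)) \<le> c * cmod (ell2_nth x n)" and "0 \<le> c"
  shows "norm y \<le> c * norm x"
proof -
  have "(\<Sum>n. (cmod (ell2_nth y (n + N)))\<^sup>2) \<le> (\<Sum>n. c\<^sup>2 * (cmod (ell2_nth x n))\<^sup>2)"
  proof (rule suminf_le)
    show "(cmod (ell2_nth y (n + N)))\<^sup>2 \<le> c\<^sup>2 * (cmod (ell2_nth x n))\<^sup>2" for n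
      using power_mono [OF assms(2), of n 2] by (simp add: power_mult_distrib)
    show "summable (\<lambda>n. (cmod (ell2_nth y (n + N)))\<^sup>2)"
      by (subst summable_iff_shift) (rule summable_ell2_nth)
  qed (intro summable_mult summable_ell2_nth)
  also have "\<dots> = c\<^sup>2 * (\<Sum>n. (cmod (ell2_nth x n))\<^sup>2)"
    by (rule suminf_mult [OF summable_ell2_nth])
  finally have "norm y \<le> sqrt (c\<^sup>2 * (\<Sum>n. (cmod (ell2_nth x n))\<^sup>2))"
    using norm_ell2_shifted [OF assms(1)] by simp
  then show ?thesis
    using assms(3) by (simp add: norm_ell2_eq real_sqrt_mult)
qed

lemma bounded_range_real:
  fixes a :: "nat \<Rightarrow> real"
  assumes "bounded (range a)"
  obtains B where "0 \<le> B" "\<And>n. \<bar>a n\<bar> \<le> B"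
proof -
  obtain b where "0 < b" "\<forall>x\<in>range a. norm x \<le> b"
    using assms unfolding bounded_pos by blast
  then show thesis
    by (intro that [of b]) auto
qed

lemma square_summable_weighted:
  fixes a :: "nat \<Rightarrow> real" and x :: "nat \<Rightarrow> complex"
  assumes "bounded (range a)" and "summable (\<lambda>n. (cmod (x n))\<^sup>2)"
  shows "summable (\<lambda>n. (cmod (complex_of_real (a n) * x n))\<^sup>2)"
proof -
  obtain B where B: "\<And>n. \<bar>a n\<bar> \<le> B"
    using bounded_range_real [OF assms(1)] by blast
  show ?thesis
  proof (rule summable_comparison_test')
    show "summable (\<lambda>n. B\<^sup>2 * (cmod (x n))\<^sup>2)"
      by (intro summable_mult assms)
    show "norm ((cmod (complex_of_real (a n) * x n))\<^sup>2) \<le> B\<^sup>2 * (cmod (x n))\<^sup>2" for n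
      using power_mono [OF B [of n], of 2]
      by (simp add: norm_mult power_mult_distrib mult_right_mono)
  qed
qed


section \<open>Polar decomposition of a weighted shift\<close>

definition diagonal_operator :: "(nat \<Rightarrow> real) \<Rightarrow> ell2 \<Rightarrow> ell2" where
  "diagonal_operator a x = Abs_ell2 (\<lambda>n. complex_of_real (a n) * ell2_nth x n)"

text \<open>For bounded weights this is the adjoint of \<open>weighted_shift a\<close>.\<close>

definition weighted_backward_shift :: "(nat \<Rightarrow> real) \<Rightarrow> ell2 \<Rightarrow> ell2" where
  "weighted_backward_shift a x = Abs_ell2 (\<lambda>n. complex_of_real (a n) * ell2_nth x (Suc n))"

lemma ell2_nth_diagonal_operator:
  "bounded (range a) \<Longrightarrow>
    ell2_nth (diagonal_operator a x) n = complex_of_real (a n) * ell2_nth x n"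
  unfolding diagonal_operator_def
  by (subst Abs_ell2_inverse) (simp_all add: square_summable_weighted summable_ell2_nth)

lemma ell2_nth_weighted_backward_shift:
  assumes "bounded (range a)"
  shows "ell2_nth (weighted_backward_shift a x) n = complex_of_real (a n) * ell2_nth x (Suc n)"
proof -
  have "summable (\<lambda>n. (cmod (ell2_nth x (Suc n)))\<^sup>2)"
    by (subst summable_Suc_iff) (rule summable_ell2_nth)
  from square_summable_weighted [OF assms this] show ?thesis
    unfolding weighted_backward_shift_def by (simp add: Abs_ell2_inverse)
qed

lemma bounded_clinear_diagonal_operator:
  assumes a: "bounded (range a)"
  shows "bounded_clinear (diagonal_operator a)"
proof -
  obtain B where B: "0 \<le> B" "\<And>n. \<bar>a n\<bar> \<le> B"
    using bounded_range_real [OF a] by blast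
  show ?thesis
  proof (rule bounded_clinearI [where K = B])
    fix x
    show "norm (diagonal_operator a x) \<le> B * norm x"
      by (rule norm_ell2_shifted_le [where N = 0])
        (simp_all add: B ell2_nth_diagonal_operator a norm_mult mult_right_mono)
  qed (auto intro!: ell2_eqI simp: ell2_nth_diagonal_operator a ell2_nth_simps algebra_simps)
qed

lemma diagonal_operator_basis:
  "bounded (range a) \<Longrightarrow> diagonal_operator a (ell2_basis k) = a k *\<^sub>R ell2_basis k"
  by (rule ell2_eqI) (simp add: ell2_nth_diagonal_operator ell2_nth_simps ell2_basis.rep_eq)

text \<open>Real diagonal entries make the quadratic form a real series. For positive weights its
  terms are nonnegative, which yields positivity of the operator and, if the sum vanishes,
  \<open>x = 0\<close>.\<close>

lemma cinner_diagonal_operator: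
  assumes a: "bounded (range a)"
  shows "summable (\<lambda>n. a n * (cmod (ell2_nth x n))\<^sup>2)"
    and "cinner (diagonal_operator a x) x
      = complex_of_real (\<Sum>n. a n * (cmod (ell2_nth x n))\<^sup>2)"
proof -
  let ?f = "\<lambda>n. a n * (cmod (ell2_nth x n))\<^sup>2"
  have eq: "ell2_nth (diagonal_operator a x) n * cnj (ell2_nth x n) = complex_of_real (?f n)" for n
    by (simp add: ell2_nth_diagonal_operator a mult.assoc complex_norm_square flip: of_real_power)
  show sm: "summable ?f"
    using summable_ell2_product [of "diagonal_operator a x" x] unfolding eq
    by (simp only: summable_complex_of_real)
  show "cinner (diagonal_operator a x) x = complex_of_real (suminf ?f)"
    unfolding cinner_ell2_def eq by (rule suminf_of_real [OF sm, symmetric])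
qed

text \<open>A positive square root \<open>P\<close> of \<open>D\<^sup>2\<close> commutes with \<open>D\<^sup>2\<close>, hence with \<open>D\<close>: its matrix entries vanish
  between different eigenvalues. So \<open>y = (P - D) e\<^sub>k\<close> satisfies \<open>(P + D) y = 0\<close>, and positivity of
  both terms gives \<open>\<langle>D y, y\<rangle> = 0\<close>, i.e.\ \<open>y = 0\<close>.\<close>

lemma operator_sqrt_diagonal:
  assumes a: "bounded (range a)" and pos: "\<And>n. 0 < a n"
  shows "operator_sqrt (diagonal_operator a \<circ> diagonal_operator a) = diagonal_operator a"
  unfolding operator_sqrt_def
proof (rule the_equality)
  let ?D = "diagonal_operator a"
  have D_ge: "0 \<le> Re (cinner (?D x) x)" for x
    using cinner_diagonal_operator [OF a] pos by (simp add: suminf_nonneg less_imp_le)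
  show "positive_operator ?D \<and> ?D \<circ> ?D = ?D \<circ> ?D"
    using cinner_diagonal_operator [OF a] pos bounded_clinear_diagonal_operator [OF a]
    by (simp add: positive_operator_def suminf_nonneg less_imp_le)
  fix P
  assume "positive_operator P \<and> P \<circ> P = ?D \<circ> ?D"
  then have P: "bounded_clinear P" and P_ge: "\<And>x. 0 \<le> Re (cinner (P x) x)"
    and PP: "\<And>x. P (P x) = ?D (?D x)"
    by (auto simp: positive_operator_def fun_eq_iff complex_nonneg_Reals_iff)
  interpret P: bounded_linear P
    using P by (simp add: bounded_clinear_def)
  interpret D: bounded_linear ?D
    using bounded_clinear_diagonal_operator [OF a] by (simp add: bounded_clinear_def)
  have DB: "?D (ell2_basis k) = a k *\<^sub>R ell2_basis k" for k
    by (rule diagonal_operator_basis [OF a])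
  show "P = ?D"
  proof (rule bounded_clinear_eq_on_basis [OF P bounded_clinear_diagonal_operator [OF a]])
    fix k
    let ?e = "ell2_basis k"
    have comm: "P (?D ?e) = ?D (P ?e)"
    proof (rule ell2_eqI)
      fix m
      have nth: "ell2_nth (?D x) n = complex_of_real (a n) * ell2_nth x n" for x n
        by (rule ell2_nth_diagonal_operator [OF a])
      \<comment> \<open>Both sides are coordinates of \<open>P (P (P ?e))\<close>: \<open>PP\<close>
        is applied to the inner pair on the left and to the outer pair on the right.\<close>
      have "ell2_nth (P (?D (?D ?e))) m = ell2_nth (?D (?D (P ?e))) m"
        by (simp flip: PP)
      then have "complex_of_real ((a k)\<^sup>2) * ell2_nth (P ?e) m
          = complex_of_real ((a m)\<^sup>2) * ell2_nth (P ?e) m"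
        by (simp add: DB D.scaleR P.scaleR power2_eq_square mult.assoc nth
            ell2_nth_simps)
      then have "a k = a m \<or> ell2_nth (P ?e) m = 0"
        using pos [of k] pos [of m]
        by (metis less_imp_le mult_cancel_right of_real_eq_iff power2_eq_iff_nonneg)
      then show "ell2_nth (P (?D ?e)) m = ell2_nth (?D (P ?e)) m"
        by (auto simp: DB P.scaleR ell2_nth_simps ell2_nth_diagonal_operator a)
    qed
    define y where "y = P ?e - ?D ?e"
    have "P y + ?D y = 0"
      by (simp add: y_def P.diff D.diff PP comm)
    then have "cinner (P y) y + cinner (?D y) y = 0"
      using cinner_scaleC_left [of 0 y y] scaleC_of_real [of 0 y]
      by (simp flip: cinner_add_left)
    then have "Re (cinner (?D y) y) = 0"
      using P_ge [of y] D_ge [of y] by (simp add: complex_eq_iff)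
    then have "(\<Sum>n. a n * (cmod (ell2_nth y n))\<^sup>2) = 0"
      by (simp add: cinner_diagonal_operator [OF a])
    then have "a n * (cmod (ell2_nth y n))\<^sup>2 = 0" for n
      using suminf_eq_zero_iff [OF cinner_diagonal_operator(1) [OF a, of y]] pos
      by (simp add: less_imp_le)
    then have "y = 0"
      using pos by (intro ell2_eqI) (simp add: zero_ell2.rep_eq less_imp_neq [symmetric])
    then show "P ?e = ?D ?e"
      by (simp add: y_def)
  qed
qed

lemma bounded_clinear_weighted_shift:
  assumes a: "bounded (range a)"
  shows "bounded_clinear (weighted_shift a)"
proof -
  obtain B where B: "0 \<le> B" "\<And>n. \<bar>a n\<bar> \<le> B"
    using bounded_range_real [OF a] by blast
  note nth = ell2_nth_weighted_shift [OF a]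
  show ?thesis
  proof (rule bounded_clinearI [where K = B])
    show "norm (weighted_shift a x) \<le> B * norm x" for x
      by (rule norm_ell2_shifted_le [where N = 1])
        (simp_all add: B nth norm_mult mult_right_mono)
    show "weighted_shift a (x + y) = weighted_shift a x + weighted_shift a y" for x y
    proof (rule ell2_eqI)
      show "ell2_nth (weighted_shift a (x + y)) n
          = ell2_nth (weighted_shift a x + weighted_shift a y) n" for n
        by (cases n) (simp_all add: nth ell2_nth_simps algebra_simps)
    qed
    show "weighted_shift a (c *\<^sub>C x) = c *\<^sub>C weighted_shift a x" for c x
    proof (rule ell2_eqI)
      show "ell2_nth (weighted_shift a (c *\<^sub>C x)) n
          = ell2_nth (c *\<^sub>C weighted_shift a x) n" for n
        by (cases n) (simp_all add: nth ell2_nth_simps algebra_simps)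
    qed
  qed
qed

text \<open>Coordinate 0 of a shifted vector is zero, so the head of the series drops and the index
  moves down by one. Pairing with basis vectors gives uniqueness.\<close>

lemma hilbert_adjoint_weighted_shift:
  assumes a: "bounded (range a)"
  shows "hilbert_adjoint (weighted_shift a) = weighted_backward_shift a"
  unfolding hilbert_adjoint_def
proof (rule the_equality)
  let ?W = "weighted_shift a" and ?B = "weighted_backward_shift a"
  show W: "\<forall>x y. cinner (?W x) y = cinner x (?B y)"
  proof (intro allI)
    fix x y
    have "cinner (?W x) y = (\<Sum>n. ell2_nth (?W x) (Suc n) * cnj (ell2_nth y (Suc n)))"
      using suminf_split_head [OF summable_ell2_product [of "?W x" y]]
      by (simp add: cinner_ell2_def ell2_nth_weighted_shift a)
    then show "cinner (?W x) y = cinner x (?B y)"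
      by (simp add: cinner_ell2_def ell2_nth_weighted_shift ell2_nth_weighted_backward_shift a
          ac_simps)
  qed
  fix S
  assume "\<forall>x y. cinner (?W x) y = cinner x (S y)"
  then have "cinner x (S y) = cinner x (?B y)" for x y
    using W by simp
  then have "cinner (S y) x = cinner (?B y) x" for x y
    using cinner_commute by metis
  then show "S = ?B"
    by (intro ext ell2_eqI) (simp flip: cinner_ell2_basis)
qed

text \<open>Shifting forth and back multiplies coordinate \<open>n\<close> by the square of
  \<open>a n\<close>, so the operator under the root is the square of a positive diagonal
  operator.\<close>

lemma abs_operator_weighted_shift:
  assumes a: "bounded (range a)" and pos: "\<And>n. 0 < a n"
  shows "abs_operator (weighted_shift a) = diagonal_operator a"
proof -
  have "weighted_backward_shift a \<circ> weighted_shift a = diagonal_operator a \<circ> diagonal_operator a"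
    by (intro ext ell2_eqI) (simp add: ell2_nth_weighted_backward_shift ell2_nth_weighted_shift
        ell2_nth_diagonal_operator a)
  then show ?thesis
    by (simp add: abs_operator_def hilbert_adjoint_weighted_shift a operator_sqrt_diagonal pos)
qed

lemma null_space_weighted_shift:
  assumes a: "bounded (range a)" and pos: "\<And>n. 0 < a n"
  shows "null_space (weighted_shift a) = {0}"
proof -
  have "x = 0" if "weighted_shift a x = 0" for x
  proof (rule ell2_eqI)
    fix n
    have "complex_of_real (a n) * ell2_nth x n = 0"
      by (simp add: that zero_ell2.rep_eq flip: ell2_nth_weighted_shift(2) [OF a])
    then show "ell2_nth x n = ell2_nth 0 n"
      using pos [of n] by (simp add: zero_ell2.rep_eq)
  qed
  moreover have "weighted_shift a 0 = 0"
    using bounded_clinear_weighted_shift [OF a] by (simp add: bounded_clinear_def linear_simps)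
  ultimately show ?thesis
    by (auto simp: null_space_def)
qed

lemma weighted_shift_basis:
  assumes a: "bounded (range a)"
  shows "weighted_shift a (ell2_basis k) = a k *\<^sub>R ell2_basis (Suc k)"
proof (rule ell2_eqI)
  show "ell2_nth (weighted_shift a (ell2_basis k)) n = ell2_nth (a k *\<^sub>R ell2_basis (Suc k)) n" for n
    by (cases n) (simp_all add: ell2_nth_weighted_shift a ell2_nth_simps ell2_basis.rep_eq)
qed

lemma bounded_range_const: "bounded (range (\<lambda>_::nat. c::real))"
  by (simp add: image_constant_conv)

text \<open>The unweighted shift is isometric and injective, and scaling by \<open>a\<close> before
  it produces the weighted shift.\<close>

lemma polar_isometry_weighted_shift:
  assumes a: "bounded (range a)" and pos: "\<And>n. 0 < a n"
  shows "polar_isometry (weighted_shift a) = weighted_shift (\<lambda>_. 1)"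
  unfolding polar_isometry_def abs_operator_weighted_shift [OF a pos]
proof (rule the_equality)
  let ?W = "weighted_shift a" and ?S = "weighted_shift (\<lambda>_. 1)" and ?D = "diagonal_operator a"
  note one = bounded_range_const [of 1]
  note S = bounded_clinear_weighted_shift [OF one]
  have "norm (?S x) = norm x" for x
    using norm_ell2_shifted [of 1 "?S x"] by (simp add: norm_ell2_eq ell2_nth_weighted_shift one)
  moreover have "?W = ?S \<circ> ?D"
  proof (intro ext ell2_eqI)
    show "ell2_nth (?W x) n = ell2_nth ((?S \<circ> ?D) x) n" for x n
      by (cases n) (simp_all add: ell2_nth_weighted_shift one a ell2_nth_diagonal_operator)
  qed
  moreover have "null_space ?S = null_space ?W"
    by (simp only: null_space_weighted_shift a one pos zero_less_one)
  ultimately show "partial_isometry ?S \<and> null_space ?S = null_space ?W \<and> ?W = ?S \<circ> ?D"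
    using S by (auto simp: partial_isometry_def)
  fix V
  assume V: "partial_isometry V \<and> null_space V = null_space ?W \<and> ?W = V \<circ> ?D"
  then have Vb: "bounded_clinear V"
    by (simp add: partial_isometry_def)
  show "V = ?S"
  proof (rule bounded_clinear_eq_on_basis [OF Vb S])
    fix k
    \<comment> \<open>Evaluating the factorisation on a basis vector and cancelling the positive
      \<open>a k\<close> determines \<open>V\<close> there.\<close>
    have "?W (ell2_basis k) = V (?D (ell2_basis k))"
      using V by (metis comp_apply)
    then have "a k *\<^sub>R ell2_basis (Suc k) = a k *\<^sub>R V (ell2_basis k)"
      using Vb by (simp add: weighted_shift_basis a diagonal_operator_basis bounded_clinear_def
          linear_simps)
    then show "V (ell2_basis k) = ?S (ell2_basis k)"
      using pos [of k] by (simp add: weighted_shift_basis one)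
  qed
qed

section \<open>The mean transform\<close>

lemma bounded_mean_weights:
  fixes a :: "nat \<Rightarrow> real"
  assumes a: "bounded (range a)"
  shows "bounded (range (\<lambda>n. (a n + a (Suc n)) / 2))"
proof -
  obtain B where B: "\<And>n. \<bar>a n\<bar> \<le> B"
    using bounded_range_real [OF a] by blast
  have "\<bar>(a n + a (Suc n)) / 2\<bar> \<le> B" for n
    using B [of n] B [of "Suc n"] abs_triangle_ineq [of "a n" "a (Suc n)"] by simp
  then show ?thesis
    by (auto simp: bounded_iff)
qed

text \<open>Coordinate \<open>m\<close> moves to \<open>Suc m\<close>; scaling before the move
  multiplies it by \<open>a m\<close>, scaling after the move by \<open>a (Suc m)\<close>, and the
  transform averages the two.\<close>

lemma mean_transform_weighted_shift:
  assumes a: "bounded (range a)" and pos: "\<And>n. 0 < a n"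
  shows "mean_transform (weighted_shift a) = weighted_shift (\<lambda>n. (a n + a (Suc n)) / 2)"
proof (intro ext ell2_eqI)
  show "ell2_nth (mean_transform (weighted_shift a) x) n
      = ell2_nth (weighted_shift (\<lambda>n. (a n + a (Suc n)) / 2) x) n" for x n
    unfolding mean_transform_def polar_isometry_weighted_shift [OF a pos]
      abs_operator_weighted_shift [OF a pos]
    by (cases n) (simp_all add: ell2_nth_simps ell2_nth_diagonal_operator
        ell2_nth_weighted_shift bounded_range_const a bounded_mean_weights field_simps)
qed


section \<open>Spectra of weighted shifts and products of weights\<close>

text \<open>For bounded weights, this is the coefficient with which the \<open>n\<close>-th power of
  the shift sends \<open>ell2_basis k\<close> to \<open>ell2_basis (k + n)\<close>.\<close>

definition weight_prod :: "(nat \<Rightarrow> real) \<Rightarrow> nat \<Rightarrow> nat \<Rightarrow> real" where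
  "weight_prod a k n = (\<Prod>i<n. a (k + i))"

lemma weight_prod_0 [simp]: "weight_prod a k 0 = 1"
  by (simp add: weight_prod_def)

lemma weight_prod_Suc: "weight_prod a k (Suc n) = weight_prod a k n * a (k + n)"
  by (simp add: weight_prod_def)

lemma weight_prod_add: "weight_prod a k (m + n) = weight_prod a k m * weight_prod a (k + m) n"
  by (induction n) (simp_all add: weight_prod_Suc ac_simps)

lemma weight_prod_pos: "(\<And>i. 0 < a i) \<Longrightarrow> 0 < weight_prod a k n"
  by (simp add: weight_prod_def prod_pos)

lemma ell2_nth_weighted_shift_funpow:
  assumes a: "bounded (range a)"
  shows "ell2_nth ((weighted_shift a ^^ N) x) (n + N)
      = complex_of_real (weight_prod a n N) * ell2_nth x n"
    and "n < N \<Longrightarrow> ell2_nth ((weighted_shift a ^^ N) x) n = 0"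
proof -
  show "ell2_nth ((weighted_shift a ^^ N) x) (n + N)
      = complex_of_real (weight_prod a n N) * ell2_nth x n"
    by (induction N) (simp_all add: ell2_nth_weighted_shift a weight_prod_Suc ac_simps)
  show "ell2_nth ((weighted_shift a ^^ N) x) n = 0" if "n < N"
    using that
  proof (induction N arbitrary: n)
    case (Suc N)
    then show ?case
      by (cases n) (simp_all add: ell2_nth_weighted_shift a)
  qed simp
qed

text \<open>The \<open>N\<close>-th power moves coordinates and multiplies them by these products,
  so \<open>c\<close> bounds its norm.\<close>

lemma not_in_spectrum_weighted_shift:
  assumes a: "bounded (range a)"
    and c: "0 \<le> c" "\<And>k. \<bar>weight_prod a k N\<bar> \<le> c" "c < cmod z ^ N"
  shows "z \<notin> spectrum (weighted_shift a)"
proof (rule not_in_spectrum_if_power_contracts [OF bounded_clinear_weighted_shift [OF a] c(1) _ c(3)])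
  show "norm ((weighted_shift a ^^ N) x) \<le> c * norm x" for x
    by (rule norm_ell2_shifted_le [where N = N])
      (simp_all add: ell2_nth_weighted_shift_funpow [OF a] c norm_mult mult_right_mono)
qed

text \<open>Column \<open>k\<close> of the resolvent follows from a forward recurrence: it is zero
  before row \<open>k\<close>, and row \<open>k + n\<close> holds
  \<open>- weight_prod a k n / z ^ Suc n\<close>. Boundedness of the resolvent bounds all columns
  uniformly.\<close>

lemma resolvent_weight_bound:
  assumes a: "bounded (range a)" and z: "z \<notin> spectrum (weighted_shift a)"
  obtains D where "z \<noteq> 0" "\<And>k m. (\<Sum>n<m. (weight_prod a k n / cmod z ^ n)\<^sup>2) \<le> D"
proof -
  let ?W = "weighted_shift a"
  obtain S where S: "bounded_clinear S" and inv: "(\<lambda>x. ?W x - z *\<^sub>C x) \<circ> S = id"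
    using z by (auto simp: spectrum_def)
  obtain C where C: "\<And>x. norm (S x) \<le> norm x * C"
    using S bounded_linear.bounded unfolding bounded_clinear_def by blast
  define s where "s k = ell2_nth (S (ell2_basis k))" for k
  have eq: "ell2_nth (?W (S (ell2_basis k))) n - z * s k n = (if n = k then 1 else 0)" for k n
  proof -
    have "?W (S (ell2_basis k)) - z *\<^sub>C S (ell2_basis k) = ell2_basis k"
      using inv by (metis comp_apply id_apply)
    then show ?thesis
      unfolding s_def by (metis ell2_basis.rep_eq ell2_nth_diff scaleC_ell2.rep_eq)
  qed
  \<comment> \<open>Shifted vectors have zero coordinate 0, so column 0 already forces
    \<open>z\<close> to be nonzero.\<close>
  have s0: "- z * s k 0 = (if k = 0 then 1 else 0)" for k
    using eq [of k 0] by (simp add: ell2_nth_weighted_shift a)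
  have sSuc: "complex_of_real (a n) * s k n - z * s k (Suc n) = (if Suc n = k then 1 else 0)" for k n
    using eq [of k "Suc n"] by (simp add: ell2_nth_weighted_shift a s_def)
  have z0: "z \<noteq> 0"
    using s0 [of 0] by auto
  have low: "s k n = 0" if "n < k" for k n
    using that
  proof (induction n)
    case 0
    then show ?case using s0 [of k] z0 by simp
  next
    case (Suc n)
    then show ?case using sSuc [of n k] z0 by simp
  qed
  have diag: "z * s k k = - 1" for k
  proof (cases k)
    case 0
    then show ?thesis using s0 [of 0] by (simp add: minus_equation_iff)
  next
    case (Suc n)
    then show ?thesis using sSuc [of n k] low [of n k] by (simp add: minus_equation_iff)
  qed
  have up: "z ^ Suc n * s k (k + n) = - complex_of_real (weight_prod a k n)" for k n
  proof (induction n)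
    case 0
    then show ?case by (simp add: diag)
  next
    case (Suc n)
    have "z * s k (Suc (k + n)) = complex_of_real (a (k + n)) * s k (k + n)"
      using sSuc [of "k + n" k] by simp
    then have "z ^ Suc (Suc n) * s k (k + Suc n)
        = complex_of_real (a (k + n)) * (z ^ Suc n * s k (k + n))"
      by (simp add: ac_simps)
    then show ?case
      by (simp only: Suc) (simp add: weight_prod_Suc)
  qed
  \<comment> \<open>The resolvent entry carries one more power of \<open>z\<close> than the quotient
    here, hence the factor \<open>(cmod z)\<^sup>2\<close>.\<close>
  have "(\<Sum>n<m. (weight_prod a k n / cmod z ^ n)\<^sup>2) \<le> (cmod z)\<^sup>2 * C\<^sup>2" for k m
  proof -
    have "(weight_prod a k n / cmod z ^ n)\<^sup>2 = (cmod z)\<^sup>2 * (cmod (s k (k + n)))\<^sup>2" for n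
    proof -
      have "cmod (z ^ Suc n * s k (k + n)) = \<bar>weight_prod a k n\<bar>"
        unfolding up by simp
      then have "\<bar>weight_prod a k n / cmod z ^ n\<bar> = cmod z * cmod (s k (k + n))"
        using z0 by (simp add: norm_mult norm_power field_simps)
      then show ?thesis
        by (metis power2_abs power_mult_distrib)
    qed
    then have "(\<Sum>n<m. (weight_prod a k n / cmod z ^ n)\<^sup>2)
        = (cmod z)\<^sup>2 * (\<Sum>n<m. (cmod (s k (k + n)))\<^sup>2)"
      by (simp add: sum_distrib_left)
    also have "(\<Sum>n<m. (cmod (s k (k + n)))\<^sup>2) = (\<Sum>i\<in>(+) k ` {..<m}. (cmod (s k i))\<^sup>2)"
      by (subst sum.reindex) simp_all
    also have "\<dots> \<le> (norm (S (ell2_basis k)))\<^sup>2"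
      unfolding s_def by (rule sum_cmod_le_norm_ell2) simp
    also have "\<dots> \<le> C\<^sup>2"
      using C [of "ell2_basis k"] by (intro power_mono) simp_all
    finally show ?thesis
      by (simp add: mult_left_mono)
  qed
  then show thesis
    using that [OF z0] by blast
qed

text \<open>Datko's argument: every splitting \<open>n = m + (n - m)\<close> factors the \<open>n\<close>-th product, so the uniform
  bound \<open>D\<close> on the sums of squares forces \<open>n\<close> times the \<open>n\<close>-th square to be at most \<open>D\<^sup>2\<close>.\<close>

lemma weight_prod_decay:
  assumes r: "0 < r" and D: "\<And>k m. (\<Sum>n<m. (weight_prod a k n / r ^ n)\<^sup>2) \<le> D"
  shows "real n * (weight_prod a k n / r ^ n)\<^sup>2 \<le> D\<^sup>2"
proof -
  define A where "A k n = (weight_prod a k n / r ^ n)\<^sup>2" for k n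
  have A_le: "A k n \<le> D" for k n
  proof -
    have "A k n \<le> (\<Sum>i<Suc n. A k i)"
      by (simp add: A_def sum_nonneg)
    then show ?thesis
      using D [of k "Suc n"] unfolding A_def by linarith
  qed
  have "D \<ge> 0"
    using D [of 0 0] by simp
  have split: "A k n = A k m * A (k + m) (n - m)" if "m < n" for m
  proof -
    have n: "n = m + (n - m)"
      using that by simp
    show ?thesis
      unfolding A_def by (subst (1 2) n)
        (simp only: weight_prod_add power_add times_divide_times_eq [symmetric] power_mult_distrib)
  qed
  have "real n * A k n = (\<Sum>m<n. A k n)"
    by simp
  also have "\<dots> \<le> (\<Sum>m<n. A k m * D)"
  proof (rule sum_mono)
    fix m
    assume "m \<in> {..<n}"
    then have "A k n = A k m * A (k + m) (n - m)"
      by (intro split) simp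
    also have "\<dots> \<le> A k m * D"
      by (intro mult_left_mono A_le) (simp add: A_def)
    finally show "A k n \<le> A k m * D" .
  qed
  also have "\<dots> = (\<Sum>m<n. A k m) * D"
    by (simp add: sum_distrib_right)
  also have "\<dots> \<le> D * D"
    using D [of k n] \<open>D \<ge> 0\<close> by (intro mult_right_mono) (simp_all add: A_def)
  finally show ?thesis
    by (simp add: A_def power2_eq_square)
qed

text \<open>AM-GM bounds each product of neighbouring weights by a squared mean. Comparing squares
  avoids roots: in the squared product all weights pair up with neighbours except one copy each of
  the first and the last, which \<open>M\<close> bounds.\<close>

lemma weight_prod_mean:
  assumes pos: "\<And>i. 0 < a i" and M: "\<And>i. a i \<le> M"
  shows "weight_prod a k (Suc n) \<le> M * weight_prod (\<lambda>i. (a i + a (Suc i)) / 2) k n"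
proof (rule power2_le_imp_le)
  let ?b = "\<lambda>i. (a i + a (Suc i)) / 2"
  have amgm: "a i * a (Suc i) \<le> (?b i)\<^sup>2" for i
    using sum_squares_ge_zero [of "a i - a (Suc i)" 0]
    by (simp add: power2_eq_square field_simps)
  have "weight_prod a k n * weight_prod a (Suc k) n \<le> (weight_prod ?b k n)\<^sup>2"
  proof (induction n)
    case (Suc n)
    have "(weight_prod a k n * weight_prod a (Suc k) n) * (a (k + n) * a (Suc (k + n)))
        \<le> (weight_prod ?b k n)\<^sup>2 * (?b (k + n))\<^sup>2"
      by (intro mult_mono Suc amgm mult_nonneg_nonneg zero_le_power2
          less_imp_le [OF pos] less_imp_le [OF weight_prod_pos] pos)
    then show ?case
      unfolding weight_prod_Suc power_mult_distrib by (simp add: ac_simps)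
  qed simp
  then have "M\<^sup>2 * (weight_prod a k n * weight_prod a (Suc k) n) \<le> (M * weight_prod ?b k n)\<^sup>2"
    unfolding power_mult_distrib by (intro mult_left_mono) simp_all
  moreover have "(weight_prod a k (Suc n))\<^sup>2 \<le> M\<^sup>2 * (weight_prod a k n * weight_prod a (Suc k) n)"
  proof -
    have first: "weight_prod a k (Suc n) = a k * weight_prod a (Suc k) n"
      using weight_prod_add [of a k 1 n] by (simp add: weight_prod_def)
    \<comment> \<open>One copy of the product gives up its last weight, the other its first.\<close>
    have "(weight_prod a k (Suc n))\<^sup>2
        = (a k * a (k + n)) * (weight_prod a k n * weight_prod a (Suc k) n)"
      unfolding power2_eq_square by (subst first) (simp add: weight_prod_Suc ac_simps)
    also have "\<dots> \<le> (M * M) * (weight_prod a k n * weight_prod a (Suc k) n)"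
      by (intro mult_right_mono mult_mono M mult_nonneg_nonneg less_imp_le pos weight_prod_pos
          less_le_trans [OF pos M])
    finally show ?thesis
      by (simp add: power2_eq_square)
  qed
  ultimately show "(weight_prod a k (Suc n))\<^sup>2 \<le> (M * weight_prod ?b k n)\<^sup>2"
    by linarith
  have "0 < ?b i" for i
    using pos [of i] pos [of "Suc i"] by simp
  then show "0 \<le> M * weight_prod ?b k n"
    by (intro mult_nonneg_nonneg less_imp_le [OF weight_prod_pos]
        less_imp_le [OF less_le_trans [OF pos M]])
qed

lemma spectrum_weighted_shift_mean:
  assumes a: "bounded (range a)" and pos: "\<And>i. 0 < a i"
  shows "spectrum (weighted_shift a) \<subseteq> spectrum (weighted_shift (\<lambda>n. (a n + a (Suc n)) / 2))"
proof (rule subsetI, rule ccontr)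
  let ?b = "\<lambda>n. (a n + a (Suc n)) / 2"
  fix z
  assume z: "z \<in> spectrum (weighted_shift a)" "z \<notin> spectrum (weighted_shift ?b)"
  obtain D where z0: "z \<noteq> 0"
    and D: "\<And>k m. (\<Sum>n<m. (weight_prod ?b k n / cmod z ^ n)\<^sup>2) \<le> D"
    using resolvent_weight_bound [OF bounded_mean_weights [OF a] z(2)] by blast
  obtain M where M: "0 \<le> M" "\<And>i. \<bar>a i\<bar> \<le> M"
    using bounded_range_real [OF a] by blast
  define r where "r = cmod z"
  have r: "0 < r" using z0 by (simp add: r_def)
  \<comment> \<open>Chosen so that \<open>M * (e * r ^ n)\<close> is half of
    \<open>r ^ Suc n\<close>, hence strictly below it.\<close>
  define e where "e = r / (2 * M)"
  have M_pos: "0 < M" using pos [of 0] M(2) [of 0] by linarith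
  have e: "0 < e" using r M_pos by (simp add: e_def)
  \<comment> \<open>For such \<open>n\<close> the bound \<open>D\<^sup>2 / n\<close> from
    \<open>weight_prod_decay\<close> lies below \<open>e\<^sup>2\<close>, simultaneously for all
    \<open>k\<close>.\<close>
  obtain n where n: "0 < n" "D\<^sup>2 / e\<^sup>2 < real n"
    using reals_Archimedean2 [of "D\<^sup>2 / e\<^sup>2"] zero_le_divide_iff [of "D\<^sup>2" "e\<^sup>2"]
    by (metis gr0I le_less_trans of_nat_0 order_less_irrefl zero_le_power2)
  have decay: "weight_prod ?b k n \<le> e * r ^ n" for k
  proof -
    have "real n * (weight_prod ?b k n / r ^ n)\<^sup>2 \<le> real n * e\<^sup>2"
      using weight_prod_decay [OF r, of ?b D n k] D n e
      by (simp add: r_def field_simps)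
    then have "(weight_prod ?b k n / r ^ n)\<^sup>2 \<le> e\<^sup>2"
      using n by simp
    then have "weight_prod ?b k n / r ^ n \<le> e"
      by (rule power2_le_imp_le) (use e in simp)
    then show ?thesis
      using r by (simp add: field_simps)
  qed
  have "weight_prod a k (Suc n) \<le> r ^ Suc n / 2" for k
  proof -
    have "weight_prod a k (Suc n) \<le> M * weight_prod ?b k n"
      by (rule weight_prod_mean [OF pos]) (use M(2) abs_le_D1 in blast)
    also have "\<dots> \<le> M * (e * r ^ n)"
      by (intro mult_left_mono decay M)
    also have "\<dots> = r ^ Suc n / 2"
      using M_pos by (simp add: e_def)
    finally show ?thesis .
  qed
  \<comment> \<open>The exponent is \<open>Suc n\<close>, since the comparison trades
    \<open>Suc n\<close> weights for \<open>n\<close> means.\<close>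
  then have "z \<notin> spectrum (weighted_shift a)"
    using weight_prod_pos [of a, OF pos] r
    by (intro not_in_spectrum_weighted_shift [OF a, of "r ^ Suc n / 2" "Suc n"])
      (simp_all add: less_imp_le r_def)
  then show False
    using z(1) by blast
qed

theorem theorem4p2:
  fixes \<alpha> :: "nat \<Rightarrow> real"
  assumes "bounded (range \<alpha>)" and "\<And>i. 0 < \<alpha> i"
  shows "spectral_radius (weighted_shift \<alpha>) \<le> spectral_radius (mean_transform (weighted_shift \<alpha>))"
proof -
  let ?\<beta> = "\<lambda>n. (\<alpha> n + \<alpha> (Suc n)) / 2"
  \<comment> \<open>Monotonicity of the supremum calls for a nonempty smaller set; by
    \<open>resolvent_weight_bound\<close>, points outside the spectrum are nonzero.\<close>
  have "0 \<in> spectrum (weighted_shift \<alpha>)"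
    using resolvent_weight_bound [OF assms(1), of 0] by blast
  then have "spectral_radius (weighted_shift \<alpha>) \<le> spectral_radius (weighted_shift ?\<beta>)"
    unfolding spectral_radius_def
    by (intro cSUP_subset_mono bdd_above_spectrum bounded_clinear_weighted_shift
        bounded_mean_weights spectrum_weighted_shift_mean assms order_refl) auto
  then show ?thesis
    by (simp add: mean_transform_weighted_shift assms)
qed

end
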